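(* Let $m\ge 2$, let $X$ and $Y$ be $p$-dimensional closed analytic submanifolds of $\mathbf{C}^m$, and let $x^0\in X\cap Y$. Suppose that the order of tangency $s(X,Y;x^0)$ is finite. If $\mathcal{L}(X,Y;x^0)\ge 1$, then $$s(X,Y;x^0)\le \mathcal{L}(X,Y;x^0)-1.$$
   Context: "Analytic" means complex analytic. $\rho$ denotes the distance induced by the standard Hermitian norm on $\mathbf{C}^m$, and $\rho(x,A)$ is the distance from the point $x$ to the set $A$. Łojasiewicz exponent: for closed analytic subsets $X,Y\subset\mathbf{C}^m$ and $x^0\in X\cap Y$, a real number $\nu>0$ is called a regular separation exponent of $X$ and $Y$ at $x^0$ if there exist a constant $c>0$ and a neighbourhood $U\subset\mathbf{C}^m$ of $x^0$ such that $\rho(x,X)+\rho(x,Y)\ge c\,\rho(x,X\cap Y)^{\nu}$ for all $x\in U$. Such exponents always exist (Łojasiewicz). $\mathcal{L}(X,Y;x^0)$ is the infimum of all regular separation exponents of $X$ and $Y$ at $x^0$. Order of tangency: for $p$-dimensional closed analytic submanifolds $X,Y$ of $\mathbf{C}^m$ and $x^0\in X\cap Y$, one says that the order of tangency between $X$ and $Y$ at $x^0$ is greater than or equal to an integer $k$ if there exist an open subset $U\subset\mathbf{C}^p$, a point $u^0\in U$, and parametrizations (i.e. biholomorphisms onto their images) $q\colon(U,u^0)\to(X,x^0)$ and $q'\colon(U,u^0)\to(Y,x^0)$ such that $$q(u)-q'(u)=o(|u-u^0|^k)\quad\text{as }U\ni u\to u^0.$$ The order of tangency $s(X,Y;x^0)$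 is the supremum of all such integers $k$. *)

theory Defs
  imports "HOL-Analysis.Analysis" "HOL-Library.Landau_Symbols"
begin

text \<open>
  The norm of \<^typ>\<open>complex^'m\<close> is the standard Hermitian norm, so \<^const>\<open>infdist\<close> is the
  distance \<open>\<rho>\<close> from a point to a (nonempty) set.
\<close>

definition regular_separation_exponent ::
    "(complex^'m) set \<Rightarrow> (complex^'m) set \<Rightarrow> complex^'m \<Rightarrow> real \<Rightarrow> bool" where
  "regular_separation_exponent X Y x0 \<nu> \<longleftrightarrow>
     \<nu> > 0 \<and>
     (\<exists>c>0. \<exists>U. open U \<and> x0 \<in> U \<and>
        (\<forall>x\<in>U. infdist x X + infdist x Y \<ge> c * infdist x (X \<inter> Y) powr \<nu>))"

definition Lojasiewicz_exponent ::
    "(complex^'m) set \<Rightarrow> (complex^'m) set \<Rightarrow> complex^'m \<Rightarrow> ereal" where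
  "Lojasiewicz_exponent X Y x0 = Inf {ereal \<nu> | \<nu>. regular_separation_exponent X Y x0 \<nu>}"

text \<open>Meant for open \<open>U\<close>: complex differentiability at every point of \<open>U\<close>.\<close>

definition holomorphic_map :: "(complex^'a \<Rightarrow> complex^'b) \<Rightarrow> (complex^'a) set \<Rightarrow> bool" where
  "holomorphic_map f U \<longleftrightarrow>
     (\<forall>x\<in>U. \<exists>f'. Vector_Spaces.linear (*s) (*s) f' \<and> (f has_derivative f') (at x))"

text \<open>
  Holomorphy on a subset that need not be open in the ambient space (such as an open piece of a
  submanifold): the map is locally the restriction of a holomorphic map of the ambient space.
\<close>

definition holomorphic_map_on_subset ::
    "(complex^'a \<Rightarrow> complex^'b) \<Rightarrow> (complex^'a) set \<Rightarrow> bool" where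
  "holomorphic_map_on_subset f A \<longleftrightarrow>
     (\<forall>y\<in>A. \<exists>V h. open V \<and> y \<in> V \<and> holomorphic_map h V \<and> (\<forall>z\<in>V \<inter> A. h z = f z))"

definition biholomorphic_between ::
    "(complex^'m \<Rightarrow> complex^'m) \<Rightarrow> (complex^'m) set \<Rightarrow> (complex^'m) set \<Rightarrow> bool" where
  "biholomorphic_between \<phi> V W \<longleftrightarrow>
     open V \<and> open W \<and> bij_betw \<phi> V W \<and>
     holomorphic_map \<phi> V \<and> holomorphic_map (the_inv_into V \<phi>) W"

text \<open>
  Around each of its points, \<open>X\<close> is mapped by an ambient holomorphic chart onto an open piece of a
  \<open>p\<close>-dimensional coordinate subspace of \<open>\<complex>\<^sup>m\<close>; \<open>J\<close> is the set of its free coordinates.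
\<close>

definition closed_analytic_submanifold :: "nat \<Rightarrow> (complex^'m) set \<Rightarrow> bool" where
  "closed_analytic_submanifold p X \<longleftrightarrow>
     closed X \<and>
     (\<forall>x\<in>X. \<exists>V W \<phi> J. x \<in> V \<and> biholomorphic_between \<phi> V W \<and> card (J :: 'm set) = p \<and>
        \<phi> ` (X \<inter> V) = {w\<in>W. \<forall>i. i \<notin> J \<longrightarrow> w $ i = 0})"

definition parametrization_at ::
    "(complex^'p \<Rightarrow> complex^'m) \<Rightarrow> (complex^'p) set \<Rightarrow> complex^'p \<Rightarrow>
     (complex^'m) set \<Rightarrow> complex^'m \<Rightarrow> bool" where
  "parametrization_at q U u0 X x0 \<longleftrightarrow>
     open U \<and> u0 \<in> U \<and> q u0 = x0 \<and>
     openin (top_of_set X) (q ` U) \<and>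
     inj_on q U \<and> holomorphic_map q U \<and> holomorphic_map_on_subset (the_inv_into U q) (q ` U)"

text \<open>
  The type argument provides the parameter space \<open>\<complex>\<^sup>p\<close>, with \<open>p = CARD('p) \<ge> 1\<close>.  Nothing is lost
  by this: for \<open>p = 0\<close> the parameter space is a point and the order of tangency is infinite.
\<close>

definition tangency_order_ge ::
    "'p::finite itself \<Rightarrow> (complex^'m) set \<Rightarrow> (complex^'m) set \<Rightarrow> complex^'m \<Rightarrow> int \<Rightarrow> bool" where
  "tangency_order_ge TYPE('p) X Y x0 k \<longleftrightarrow>
     (\<exists>(U :: (complex^'p) set) u0 q q'.
        parametrization_at q U u0 X x0 \<and> parametrization_at q' U u0 Y x0 \<and>
        (\<lambda>u. norm (q u - q' u)) \<in> o[at u0 within U](\<lambda>u. norm (u - u0) powi k))"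

definition tangency_order ::
    "'p::finite itself \<Rightarrow> (complex^'m) set \<Rightarrow> (complex^'m) set \<Rightarrow> complex^'m \<Rightarrow> ereal" where
  "tangency_order TYPE('p) X Y x0 =
     Sup {ereal (of_int k) | k. tangency_order_ge TYPE('p) X Y x0 k}"

end

theory Submission imports Defs "HOL-Complex_Analysis.Conformal_Mappings" begin

text \<open>
  Let \<open>q\<close>, \<open>q'\<close> be parametrizations that realize tangency of order \<open>k \<ge> 1\<close>. If all equations of \<open>Y\<close>
  vanished on \<open>q\<close> near \<open>u0\<close>, then invariance of domain would make \<open>q\<close> a parametrization of \<open>Y\<close> as well,
  and the order of tangency would be infinite. So some equation \<open>f\<close> of \<open>Y\<close>, pulled back by \<open>q\<close>, has a nonzero
  lowest homogeneous part at \<open>u0\<close>. If \<open>v\<close> is a direction in which that part does not vanish, then \<open>f\<close> has no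
  zero in the balls of radius \<open>\<epsilon> t\<close> around \<open>u0 + t v\<close>. The inverse of \<open>q\<close> is Lipschitz, hence
  the distance from \<open>x = q (u0 + t v)\<close> to \<open>X \<inter> Y\<close> is at least a constant times \<open>t\<close>. On the other hand \<open>x \<in> X\<close>,
  and the distance from \<open>x\<close> to \<open>Y\<close> is at most the norm of \<open>q - q'\<close> at \<open>u0 + t v\<close>; this is
  \<open>o(t\<^sup>k)\<close> and holomorphic in \<open>t\<close>, hence \<open>O(t\<^sup>k\<^sup>+\<^sup>1)\<close>. So every regular separation exponent is at least
  \<open>k + 1\<close>. For \<open>k \<le> 0\<close> the assumption that the exponent is at least 1 suffices.
\<close>

section \<open>Holomorphic maps of several variables and their restrictions to complex lines\<close>

lemma norm_vector_scalar_mult_complex: "norm (c *s (x :: complex^'n)) = norm c * norm x"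
  by (simp add: norm_vec_def norm_mult L2_set_right_distrib)

lemma bounded_linear_vector_scalar_mult: "bounded_linear (\<lambda>t. t *s (w :: complex^'n))"
  by (rule bounded_linear_intro [where K = "norm w"])
    (simp_all add: norm_vector_scalar_mult_complex vec_eq_iff algebra_simps)

lemma tendsto_ray: "((\<lambda>t. a + of_real t *s v) \<longlongrightarrow> (a :: complex^'n)) (at_right (0::real))"
proof -
  have "((\<lambda>t. a + of_real t *s v) \<longlongrightarrow> a + of_real 0 *s v) (at_right (0::real))"
    by (intro tendsto_intros bounded_linear.tendsto [OF bounded_linear_vector_scalar_mult])
  then show ?thesis by simp
qed

lemma norm_complex_vec_le_card:
  fixes x :: "complex^'n" and B :: real
  assumes "\<And>i. norm (x $ i) \<le> B"
  shows "norm x \<le> CARD('n) * B"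
proof -
  have "norm x \<le> (\<Sum>i\<in>UNIV. norm (x $ i))"
    unfolding norm_vec_def by (rule L2_set_le_sum) simp
  also have "\<dots> \<le> CARD('n) * B"
    using sum_bounded_above [of UNIV "\<lambda>i. norm (x $ i)" B] assms by simp
  finally show ?thesis .
qed

lemma holomorphic_map_mono: "holomorphic_map f S \<Longrightarrow> T \<subseteq> S \<Longrightarrow> holomorphic_map f T"
  by (auto simp: holomorphic_map_def)

lemma holomorphic_map_imp_continuous_on: "holomorphic_map f S \<Longrightarrow> continuous_on S f"
  unfolding holomorphic_map_def
  by (meson continuous_at_imp_continuous_on has_derivative_continuous)

lemma holomorphic_map_compose:
  assumes "holomorphic_map f S" "holomorphic_map g T" "f ` S \<subseteq> T"
  shows "holomorphic_map (g \<circ> f) S"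
  unfolding holomorphic_map_def
proof
  fix x assume "x \<in> S"
  obtain f' where f': "Vector_Spaces.linear (*s) (*s) f'" "(f has_derivative f') (at x)"
    using assms(1) \<open>x \<in> S\<close> unfolding holomorphic_map_def by blast
  obtain g' where g': "Vector_Spaces.linear (*s) (*s) g'" "(g has_derivative g') (at (f x))"
    using assms(2,3) \<open>x \<in> S\<close> unfolding holomorphic_map_def by blast
  show "\<exists>h. Vector_Spaces.linear (*s) (*s) h \<and> (g \<circ> f has_derivative h) (at x)"
    using diff_chain_at [OF f'(2) g'(2)] Vector_Spaces.linear_compose [OF f'(1) g'(1)] by blast
qed

lemma holomorphic_map_slice:
  assumes "holomorphic_map f S" "\<And>t. t \<in> T \<Longrightarrow> a + t *s w \<in> S"
  shows "(\<lambda>t. f (a + t *s w) $ i) holomorphic_on T"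
  unfolding holomorphic_on_def
proof
  fix t assume "t \<in> T"
  then obtain f' where f': "Vector_Spaces.linear (*s) (*s) f'"
      "(f has_derivative f') (at (a + t *s w))"
    using assms unfolding holomorphic_map_def by blast
  have "((\<lambda>t. a + t *s w) has_derivative (\<lambda>t. t *s w)) (at t)"
    using bounded_linear_imp_has_derivative [OF bounded_linear_vector_scalar_mult, of w "at t"]
    by (auto intro!: derivative_eq_intros)
  from diff_chain_at [OF this f'(2)]
  have "((\<lambda>t. f (a + t *s w) $ i) has_derivative (\<lambda>t. f' (t *s w) $ i)) (at t)"
    by (auto simp: o_def intro: bounded_linear.has_derivative [OF bounded_linear_vec_nth])
  \<comment> \<open>Complex homogeneity of \<open>f'\<close> turns the real derivative along the
    line into multiplication by a complex number, that is, into a complex derivative in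
    \<open>t\<close>.\<close>
  moreover have "f' (s *s w) = s *s f' w" for s
    using f'(1) by (simp add: Vector_Spaces.linear_iff)
  ultimately have "((\<lambda>t. f (a + t *s w) $ i) has_field_derivative (f' w $ i)) (at t)"
    unfolding has_field_derivative_def by (simp add: mult.commute [of _ "f' w $ i"] cong: if_cong)
  then show "(\<lambda>t. f (a + t *s w) $ i) field_differentiable at t within T"
    using field_differentiable_at_within field_differentiable_def by blast
qed

section \<open>Estimates on complex lines: Taylor remainders, Lipschitz bounds, zero-free cones,
  vanishing orders\<close>

lemma Taylor_remainder_bound:
  fixes f :: "complex \<Rightarrow> complex"
  assumes holf: "f holomorphic_on ball 0 r" and bound: "\<And>z. z \<in> ball 0 r \<Longrightarrow> norm (f z) \<le> M"
    and "norm z \<le> r/2" "0 < r"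
  shows "norm (f z - (\<Sum>i\<le>n. (deriv ^^ i) f 0 * z ^ i / fact i))
           \<le> (fact (Suc n) * M / (r/4) ^ Suc n) / fact n * norm z ^ Suc n"
proof -
  \<comment> \<open>Discs of radius \<open>r/4\<close> centred in \<open>cball 0 (r/2)\<close> stay
    inside \<open>ball 0 r\<close>, so Cauchy's inequality bounds the derivative of order
    \<open>Suc n\<close> by one constant on the whole smaller disc.\<close>
  have "norm ((deriv ^^ Suc n) f x) \<le> fact (Suc n) * M / (r/4) ^ Suc n" if "x \<in> cball 0 (r/2)" for x
  proof (rule Cauchy_inequality)
    have sub: "cball x (r/4) \<subseteq> ball 0 r"
    proof
      fix y assume "y \<in> cball x (r/4)"
      then show "y \<in> ball 0 r"
        using that \<open>0 < r\<close> norm_triangle_ineq2 [of y x] by (auto simp: dist_norm norm_minus_commute)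
    qed
    show "f holomorphic_on ball x (r/4)"
      using holf sub by (meson ball_subset_cball holomorphic_on_subset subset_trans)
    show "continuous_on (cball x (r/4)) f"
      using holf sub by (meson holomorphic_on_subset holomorphic_on_imp_continuous_on)
    show "norm (f y) \<le> M" if "norm (x - y) = r/4" for y
      using that sub by (intro bound) (auto simp: dist_norm)
  qed (use \<open>0 < r\<close> in auto)
  moreover have "((deriv ^^ i) f has_field_derivative (deriv ^^ Suc i) f x) (at x within cball 0 (r/2))"
    if "x \<in> cball 0 (r/2)" for x i
  proof (rule has_field_derivative_at_within)
    have "x \<in> ball 0 r" using that \<open>0 < r\<close> by auto
    then show "((deriv ^^ i) f has_field_derivative (deriv ^^ Suc i) f x) (at x)"
      using holomorphic_higher_deriv [OF holf open_ball] holomorphic_derivI by fastforce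
  qed
  ultimately have "norm ((deriv ^^ 0) f z - (\<Sum>i\<le>n. (deriv ^^ i) f 0 * (z - 0) ^ i / fact i))
    \<le> (fact (Suc n) * M / (r/4) ^ Suc n) * norm (z - 0) ^ Suc n / fact n"
    using assms(3,4)
    by (intro complex_Taylor [where S = "cball 0 (r/2)" and f = "\<lambda>i. (deriv ^^ i) f"]) auto
  then show ?thesis by simp
qed

lemma holomorphic_map_bounded_near:
  assumes "holomorphic_map f V" "open V" "a \<in> V"
  obtains r M where "0 < r" "cball a r \<subseteq> V" "0 < M" "\<And>x. x \<in> cball a r \<Longrightarrow> norm (f x) \<le> M"
proof -
  obtain r where r: "0 < r" "cball a r \<subseteq> V"
    using assms(2,3) open_contains_cball by metis
  then have "continuous_on (cball a r) f"
    using assms(1) holomorphic_map_imp_continuous_on continuous_on_subset by blast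
  then have "bounded (f ` cball a r)"
    by (intro compact_imp_bounded compact_continuous_image) auto
  then obtain M where "0 < M" "\<And>x. x \<in> cball a r \<Longrightarrow> norm (f x) \<le> M"
    unfolding bounded_pos by auto
  with r show thesis by (rule that)
qed

text \<open>On the complex line through \<open>x\<close> and \<open>y\<close>, parametrized so that
  \<open>t = 0\<close> is \<open>y\<close> and \<open>t = 1\<close> is \<open>x\<close>, each
  component of \<open>h\<close> is holomorphic and bounded on a disc whose radius is inversely
  proportional to \<open>norm (x - y)\<close>. The Taylor remainder of order 0 at
  \<open>t = 1\<close> is then linear in \<open>norm (x - y)\<close>.\<close>

lemma holomorphic_map_Lipschitz_near:
  fixes h :: "complex^'n \<Rightarrow> complex^'k"
  assumes "holomorphic_map h V" "open V" "a \<in> V"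
  obtains \<delta> L where "0 < \<delta>" "ball a \<delta> \<subseteq> V" "0 < L"
    "\<And>x y. x \<in> ball a \<delta> \<Longrightarrow> y \<in> ball a \<delta> \<Longrightarrow> norm (h x - h y) \<le> L * norm (x - y)"
proof -
  obtain r M where r: "0 < r" "cball a r \<subseteq> V" "0 < M" "\<And>x. x \<in> cball a r \<Longrightarrow> norm (h x) \<le> M"
    using holomorphic_map_bounded_near [OF assms] by blast
  \<comment> \<open>The radius \<open>r/8\<close> gives \<open>d \<le> r/4\<close>, so
    \<open>t = 1\<close> lies in the inner half of the disc of radius \<open>r/2/d\<close>, which
    the line maps into \<open>cball a r\<close>. The factor \<open>CARD('k)\<close> comes from
    passing from components to the norm.\<close>
  have "norm (h x - h y) \<le> CARD('k) * (8 * M / r) * norm (x - y)"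
    if xy: "x \<in> ball a (r/8)" "y \<in> ball a (r/8)" for x y
  proof (cases "x = y")
    case False
    define d where "d = norm (x - y)"
    have "0 < d" using False by (simp add: d_def)
    have "d \<le> r/4"
      using xy dist_triangle3 [of x y a] by (auto simp: d_def dist_norm)
    have in_ball: "y + t *s (x - y) \<in> cball a r" if "t \<in> ball 0 (r/2/d)" for t
    proof -
      have "norm (t *s (x - y)) \<le> r/2"
        using that \<open>0 < d\<close> unfolding norm_vector_scalar_mult_complex d_def [symmetric]
        by (simp add: field_simps)
      moreover have "norm (y - a) \<le> r/8" using xy by (simp add: dist_norm norm_minus_commute)
      ultimately have "norm ((y - a) + t *s (x - y)) \<le> r"
        using norm_triangle_ineq [of "y - a" "t *s (x - y)"] \<open>0 < r\<close> by linarith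
      then show ?thesis by (simp add: dist_norm norm_minus_commute add_diff_eq algebra_simps)
    qed
    have "norm ((h x - h y) $ i) \<le> 8 * M / r * d" for i
    proof -
      let ?F = "\<lambda>t. h (y + t *s (x - y)) $ i"
      have "norm (?F 1 - (\<Sum>i\<le>0. (deriv ^^ i) ?F 0 * 1 ^ i / fact i))
           \<le> (fact (Suc 0) * M / (r/2/d/4) ^ Suc 0) / fact 0 * norm (1::complex) ^ Suc 0"
      proof (rule Taylor_remainder_bound)
        show "?F holomorphic_on ball 0 (r/2/d)"
          using in_ball r(2) by (intro holomorphic_map_slice [OF assms(1)]) blast
        show "norm (?F t) \<le> M" if "t \<in> ball 0 (r/2/d)" for t
          using r(4) [OF in_ball [OF that]] Finite_Cartesian_Product.norm_nth_le order_trans by blast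
        show "norm (1::complex) \<le> r/2/d/2" "0 < r/2/d"
          using \<open>d \<le> r/4\<close> \<open>0 < d\<close> \<open>0 < r\<close> by (auto simp: field_simps)
      qed
      then show ?thesis using \<open>0 < d\<close> \<open>0 < r\<close> by (simp add: field_simps)
    qed
    from norm_complex_vec_le_card [OF this] show ?thesis by (simp add: d_def mult.assoc)
  qed simp
  moreover have "ball a (r/8) \<subseteq> V" using r(1,2) by (auto simp: subset_iff)
  ultimately show thesis
    using that [of "r/8" "CARD('k) * (8 * M / r)"] r(1,3) by simp
qed

text \<open>The component may have zeros arbitrarily close to \<open>a\<close>, but not inside a
  thin cone around a suitable direction \<open>v\<close>: there the lowest homogeneous part
  dominates the Taylor remainder, with constants uniform over the directions in the cone.\<close>

lemma holomorphic_map_nonzero_cone: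
  fixes F :: "complex^'n \<Rightarrow> complex^'k"
  assumes hol: "holomorphic_map F (ball a R)" and w0: "w0 \<in> ball a R" "F w0 $ i \<noteq> 0"
  obtains v \<epsilon> \<delta> where "0 < \<epsilon>" "0 < \<delta>"
    "\<And>t x. \<lbrakk>0 < t; t < \<delta>; x \<in> ball (a + complex_of_real t *s v) (\<epsilon> * t)\<rbrakk> \<Longrightarrow> F x $ i \<noteq> 0"
proof -
  \<comment> \<open>With \<open>r\<close> strictly between \<open>norm (w0 - a)\<close> and
    \<open>R\<close>, the direction \<open>w0 - a\<close> is admissible, and every slice
    \<open>g w\<close> with \<open>norm w \<le> r\<close> is holomorphic beyond the closed unit
    disc.\<close>
  define r where "r = (norm (w0 - a) + R) / 2"
  have "norm (w0 - a) < R" using w0(1) by (simp add: dist_norm norm_minus_commute)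
  moreover from this have "0 < R" using norm_ge_zero [of "w0 - a"] by linarith
  ultimately have r: "norm (w0 - a) < r" "r < R" "0 < r"
    by (auto simp: r_def add_nonneg_pos)
  define g where "g = (\<lambda>w t. F (a + t *s w) $ i)"
  have in_cball: "a + t *s w \<in> cball a r" if "norm w \<le> r" "norm t \<le> 1" for t w
    using mult_mono [OF that(2,1)] by (simp add: dist_norm norm_vector_scalar_mult_complex)
  have cont: "continuous_on (cball a r) (\<lambda>x. F x $ i)"
    using r(2) by (intro continuous_intros continuous_on_subset
        [OF holomorphic_map_imp_continuous_on [OF hol]]) auto
  have hol_g: "g w holomorphic_on ball 0 (R / r)" if "norm w \<le> r" for w
    unfolding g_def
  proof (rule holomorphic_map_slice [OF hol])
    fix t assume "t \<in> ball (0::complex) (R / r)"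
    then have "norm t * norm w < R"
      using mult_left_mono [OF that, of "norm t"] r(3) by (simp add: field_simps)
    then show "a + t *s w \<in> ball a R"
      by (simp add: dist_norm norm_vector_scalar_mult_complex)
  qed
  have sub: "cball 0 1 \<subseteq> ball (0::complex) (R / r)"
  proof -
    have "1 < R / r" using r by simp
    then show ?thesis by auto
  qed
  have hol_g1: "g w holomorphic_on ball 0 1" if "norm w \<le> r" for w
    using hol_g [OF that] sub by (meson ball_subset_cball holomorphic_on_subset subset_trans)
  have cont_g: "continuous_on (cball 0 1) (g w)" if "norm w \<le> r" for w
    using hol_g [OF that] sub by (meson holomorphic_on_subset holomorphic_on_imp_continuous_on)
  \<comment> \<open>\<open>D d w / d!\<close> is the lowest homogeneous part of \<open>F\<close> (component \<open>i\<close>) at \<open>a\<close>, evaluated at \<open>w\<close>. It is continuous in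
    \<open>w\<close>, so it stays away from 0 near a direction \<open>v\<close> at which it does not vanish.\<close>
  define D where "D = (\<lambda>n w. (deriv ^^ n) (g w) 0)"
  define d where "d = (LEAST n. \<exists>w. norm w < r \<and> D n w \<noteq> 0)"
  \<comment> \<open>If all these derivatives vanished, the slice towards \<open>w0\<close> would be
    identically zero, although its value at \<open>t = 1\<close> is \<open>F w0 $ i\<close>.\<close>
  have "\<exists>n w. norm w < r \<and> D n w \<noteq> 0"
  proof (rule ccontr)
    assume "\<not> ?thesis"
    then have "(deriv ^^ n) (g (w0 - a)) 0 = 0" for n
      using r(1) by (auto simp: D_def)
    then have "g (w0 - a) 1 = 0"
      using holomorphic_fun_eq_0_on_ball [OF hol_g, of "w0 - a" 1] r by simp
    then show False using w0(2) by (simp add: g_def)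
  qed
  then have "\<exists>w. norm w < r \<and> D d w \<noteq> 0"
    unfolding d_def by (rule LeastI_ex)
  then obtain v where v: "norm v < r" "D d v \<noteq> 0" by blast
  have low: "D n w = 0" if "n < d" "norm w < r" for n w
    using not_less_Least [OF that(1) [unfolded d_def]] that(2) by blast
  \<comment> \<open>This is half the size of the leading coefficient at \<open>v\<close>; a change
    by at most \<open>\<eta>\<close> leaves at least \<open>\<eta>\<close>.\<close>
  define \<eta> where "\<eta> = norm (D d v) / (2 * fact d)"
  have "0 < \<eta>" using v(2) by (simp add: \<eta>_def)
  have ucont: "uniformly_continuous_on (cball a r) (\<lambda>x. F x $ i)"
    using cont by (simp add: compact_uniformly_continuous)
  obtain e where e: "0 < e" and unif: "\<And>x y. \<lbrakk>x \<in> cball a r; y \<in> cball a r; dist x y < e\<rbrakk>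
      \<Longrightarrow> dist (F x $ i) (F y $ i) < \<eta>"
    using ucont \<open>0 < \<eta>\<close> unfolding uniformly_continuous_on_def by metis
  \<comment> \<open>The term \<open>r - norm v\<close> keeps \<open>w\<close> admissible. The term
    \<open>e\<close> makes \<open>g w\<close> and \<open>g v\<close> differ by less than
    \<open>\<eta>\<close> on the unit circle, so Cauchy's inequality controls the change of the
    \<open>d\<close>-th derivative at 0.\<close>
  define \<epsilon> where "\<epsilon> = min e (r - norm v)"
  have "0 < \<epsilon>" using e v(1) by (simp add: \<epsilon>_def)
  have near: "norm w < r \<and> norm (D d w) \<ge> fact d * \<eta>" if "norm (w - v) < \<epsilon>" for w
  proof -
    have w: "norm w < r"
      using that norm_triangle_ineq2 [of w v] by (simp add: \<epsilon>_def)
    have "norm ((deriv ^^ d) (\<lambda>t. g w t - g v t) 0) \<le> fact d * \<eta> / 1 ^ d"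
    proof (rule Cauchy_inequality)
      show "(\<lambda>t. g w t - g v t) holomorphic_on ball 0 1"
        using hol_g1 v(1) w by (intro holomorphic_on_diff) auto
      show "continuous_on (cball 0 1) (\<lambda>t. g w t - g v t)"
        using cont_g v(1) w by (intro continuous_on_diff) auto
      fix t :: complex assume "norm (0 - t) = 1"
      then have t: "norm t = 1" by simp
      have "dist (a + t *s w) (a + t *s v) = norm (t *s (w - v))"
        by (simp add: dist_norm vector_ssub_ldistrib)
      also have "\<dots> < e"
        unfolding norm_vector_scalar_mult_complex using that t by (simp add: \<epsilon>_def)
      finally have "dist (a + t *s w) (a + t *s v) < e" .
      then have "dist (g w t) (g v t) < \<eta>"
        unfolding g_def using t v(1) w by (intro unif in_cball) auto
      then show "norm (g w t - g v t) \<le> \<eta>" by (simp add: dist_norm)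
    qed simp
    moreover have "(deriv ^^ d) (\<lambda>t. g w t - g v t) 0 = D d w - D d v"
      unfolding D_def using hol_g1 v(1) w by (intro higher_deriv_diff [where S = "ball 0 1"]) auto
    ultimately have "norm (D d w - D d v) \<le> fact d * \<eta>" by simp
    moreover have "norm (D d v) = 2 * (fact d * \<eta>)" by (simp add: \<eta>_def)
    moreover have "norm (D d v) - norm (D d w) \<le> norm (D d w - D d v)"
      by (metis norm_minus_commute norm_triangle_ineq2)
    ultimately show ?thesis using w by linarith
  qed
  have "bounded ((\<lambda>x. F x $ i) ` cball a r)"
    using cont by (intro compact_imp_bounded compact_continuous_image) auto
  then obtain M where M: "0 < M" "\<And>x. x \<in> cball a r \<Longrightarrow> norm (F x $ i) \<le> M"
    unfolding bounded_pos by auto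
  define C where "C = (fact (Suc d) * M / (1/4) ^ Suc d) / fact d"
  have "0 < C" using M(1) by (simp add: C_def)
  \<comment> \<open>At a zero, the leading term, at least \<open>\<eta> * norm t ^ d\<close>, would
    be bounded by the remainder \<open>C * norm t ^ Suc d\<close>; this fails for
    \<open>norm t < \<eta> / C\<close>. The bound \<open>1/2\<close> is the range of the Taylor
    estimate on the unit disc.\<close>
  have g_nz: "g w t \<noteq> 0" if "norm (w - v) < \<epsilon>" "t \<noteq> 0" "norm t < min (1/2) (\<eta> / C)" for w t
  proof
    assume "g w t = 0"
    have w: "norm w < r" "norm (D d w) \<ge> fact d * \<eta>" using near [OF that(1)] by auto
    have "norm (g w t - (\<Sum>n\<le>d. (deriv ^^ n) (g w) 0 * t ^ n / fact n)) \<le> C * norm t ^ Suc d"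
      unfolding C_def
    proof (rule Taylor_remainder_bound)
      show "norm (g w z) \<le> M" if "z \<in> ball 0 1" for z
        unfolding g_def using that w(1) by (intro M in_cball) auto
    qed (use hol_g1 w(1) that(3) in auto)
    also have "(\<Sum>n\<le>d. (deriv ^^ n) (g w) 0 * t ^ n / fact n) = D d w * t ^ d / fact d"
    proof -
      have "(\<Sum>n\<le>d. (deriv ^^ n) (g w) 0 * t ^ n / fact n)
          = (\<Sum>n\<in>{d}. (deriv ^^ n) (g w) 0 * t ^ n / fact n)"
        using low w(1) by (intro sum.mono_neutral_right) (auto simp: D_def)
      then show ?thesis by (simp add: D_def)
    qed
    finally have "norm (D d w) / fact d * norm t ^ d \<le> C * norm t * norm t ^ d"
      using \<open>g w t = 0\<close> by (simp add: norm_mult norm_divide norm_power mult.assoc)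
    then have "norm (D d w) / fact d \<le> C * norm t"
      by (rule mult_right_le_imp_le) (use that(2) in simp)
    moreover have "norm (D d w) / fact d \<ge> \<eta>" using w(2) by (simp add: field_simps)
    moreover have "C * norm t < \<eta>" using that(3) \<open>0 < C\<close> by (simp add: field_simps)
    ultimately show False by simp
  qed
  show thesis
  proof (rule that [of \<epsilon> "min (1/2) (\<eta> / C)" v])
    fix t x assume t: "0 < t" "t < min (1/2) (\<eta> / C)"
      and x: "x \<in> ball (a + complex_of_real t *s v) (\<epsilon> * t)"
    \<comment> \<open>Rescaling by \<open>1/t\<close> carries the ball of radius
      \<open>\<epsilon> * t\<close> around the ray point to the directions within
      \<open>\<epsilon>\<close> of \<open>v\<close>.\<close>
    define w where "w = complex_of_real (1/t) *s (x - a)"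
    have x_eq: "x = a + complex_of_real t *s w"
      using t(1) by (simp add: w_def vector_smult_assoc flip: of_real_mult)
    have "norm (complex_of_real t *s (w - v)) < \<epsilon> * t"
      using x unfolding x_eq by (simp add: dist_norm vector_ssub_ldistrib norm_minus_commute)
    then have "norm (w - v) < \<epsilon>"
      unfolding norm_vector_scalar_mult_complex using t(1) by (simp add: mult.commute)
    then have "g w t \<noteq> 0" using t by (intro g_nz) auto
    then show "F x $ i \<noteq> 0" by (simp add: g_def x_eq)
  qed (use \<open>0 < \<epsilon>\<close> \<open>0 < \<eta>\<close> \<open>0 < C\<close> in auto)
qed

text \<open>A holomorphic function that is not identically zero vanishes at 0 to an integer order
  \<open>n\<close>. Being \<open>o(t^k)\<close> along the positive reals excludes
  \<open>n \<le> k\<close>, and the next integer is \<open>k + 1\<close>.\<close>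

lemma holomorphic_smallo_imp_bigo_Suc:
  fixes f :: "complex \<Rightarrow> complex"
  assumes holf: "f holomorphic_on ball 0 r" and "0 < r"
    and small: "\<And>c. 0 < c \<Longrightarrow> \<forall>\<^sub>F t in at_right (0::real). norm (f (of_real t)) \<le> c * t ^ k"
  shows "\<exists>C>0. \<forall>\<^sub>F t in at_right (0::real). norm (f (of_real t)) \<le> C * t ^ Suc k"
proof -
  have tend_id: "((\<lambda>t. complex_of_real t) \<longlongrightarrow> 0) (at_right 0)"
    by (auto intro!: tendsto_eq_intros)
  have isCont_f: "isCont f 0"
    using holf \<open>0 < r\<close> by (meson centre_in_ball holomorphic_on_imp_continuous_on
        continuous_on_eq_continuous_at open_ball)
  have "f 0 = 0"
  proof (rule ccontr)
    assume "f 0 \<noteq> 0"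
    have "((\<lambda>t. norm (f (of_real t))) \<longlongrightarrow> norm (f 0)) (at_right 0)"
      using isCont_tendsto_compose [OF isCont_f tend_id] by (rule tendsto_norm)
    then have "\<forall>\<^sub>F t in at_right (0::real). norm (f (of_real t)) > norm (f 0) / 2"
      using \<open>f 0 \<noteq> 0\<close> by (intro order_tendstoD) auto
    moreover have "\<forall>\<^sub>F t in at_right (0::real). norm (f (of_real t)) \<le> norm (f 0) / 2 * t ^ k"
      using \<open>f 0 \<noteq> 0\<close> by (intro small) auto
    moreover have "\<forall>\<^sub>F t in at_right (0::real). 0 < t \<and> t < 1"
      unfolding eventually_at_right_field by (intro exI [of _ 1]) auto
    ultimately have "\<forall>\<^sub>F t in at_right (0::real). False"
    proof eventually_elim
      case (elim t)
      then have "norm (f 0) / 2 * t ^ k \<le> norm (f 0) / 2 * 1"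
        by (intro mult_left_mono power_le_one) auto
      then show False using elim by simp
    qed
    then show False by simp
  qed
  show ?thesis
  \<comment> \<open>A constant \<open>f\<close> is zero because \<open>f 0 = 0\<close>; it has no
    finite vanishing order and is treated apart from the factorization.\<close>
  proof (cases "f constant_on ball 0 r")
    case True
    then have "f z = 0" if "z \<in> ball 0 r" for z
      using that \<open>f 0 = 0\<close> \<open>0 < r\<close> unfolding constant_on_def by force
    moreover have "\<forall>\<^sub>F t in at_right (0::real). 0 < t \<and> t < r"
      unfolding eventually_at_right_field using \<open>0 < r\<close> by (intro exI [of _ r]) auto
    ultimately have "\<forall>\<^sub>F t in at_right (0::real). norm (f (of_real t)) \<le> 1 * t ^ Suc k"
      by (auto elim!: eventually_mono)
    then show ?thesis using zero_less_one by blast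
  next
    case False
    have zero_in: "0 \<in> ball 0 r" using \<open>0 < r\<close> by simp
    obtain g s n where "0 < n" and s: "0 < s" "ball 0 s \<subseteq> ball (0::complex) r"
      and holg: "g holomorphic_on ball 0 s"
      and feq: "\<And>w. w \<in> ball 0 s \<Longrightarrow> f w = (w - 0) ^ n * g w"
      and gnz: "\<And>w. w \<in> ball 0 s \<Longrightarrow> g w \<noteq> 0"
    proof (rule holomorphic_factor_zero_nonconstant
          [OF holf open_ball connected_ball zero_in \<open>f 0 = 0\<close> False], goal_cases)
      case (1 g s n)
      show ?case by (rule 1(1) [of n s g]) (fact 1)+
    qed
    have "g 0 \<noteq> 0" using gnz s(1) by simp
    have "isCont g 0"
      using holg s(1) by (meson centre_in_ball holomorphic_on_imp_continuous_on
          continuous_on_eq_continuous_at open_ball)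
    then have tend: "((\<lambda>t. norm (g (of_real t))) \<longlongrightarrow> norm (g 0)) (at_right 0)"
      using isCont_tendsto_compose tend_id tendsto_norm by blast
    have in_s: "\<forall>\<^sub>F t in at_right (0::real). 0 < t \<and> t < min s 1"
      unfolding eventually_at_right_field using s(1) by (intro exI [of _ "min s 1"]) auto
    have "k < n"
    proof (rule ccontr)
      assume "\<not> k < n"
      have "\<forall>\<^sub>F t in at_right (0::real). norm (g (of_real t)) > norm (g 0) / 2"
        using \<open>g 0 \<noteq> 0\<close> by (intro order_tendstoD(1) [OF tend]) auto
      moreover have "\<forall>\<^sub>F t in at_right (0::real). norm (f (of_real t)) \<le> norm (g 0) / 2 * t ^ k"
        using \<open>g 0 \<noteq> 0\<close> by (intro small) auto
      ultimately have "\<forall>\<^sub>F t in at_right (0::real). False"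
        using in_s
      proof eventually_elim
        case (elim t)
        have "t ^ n * norm (g (of_real t)) \<le> norm (g 0) / 2 * t ^ k"
          using elim feq [of "of_real t"] by (simp add: norm_mult norm_power)
        also have "\<dots> \<le> norm (g 0) / 2 * t ^ n"
          using elim \<open>\<not> k < n\<close> by (intro mult_left_mono power_decreasing) auto
        finally have "norm (g (of_real t)) \<le> norm (g 0) / 2"
          using elim by (simp add: mult.commute)
        then show False using elim by simp
      qed
      then show False by simp
    qed
    have "\<forall>\<^sub>F t in at_right (0::real). norm (g (of_real t)) < norm (g 0) + 1"
      by (intro order_tendstoD(2) [OF tend]) auto
    then have "\<forall>\<^sub>F t in at_right (0::real). norm (f (of_real t)) \<le> (norm (g 0) + 1) * t ^ Suc k"
      using in_s
    proof eventually_elim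
      case (elim t)
      have "norm (f (of_real t)) = norm (g (of_real t)) * t ^ n"
        using elim feq [of "of_real t"] by (simp add: norm_mult norm_power)
      also have "\<dots> \<le> (norm (g 0) + 1) * t ^ Suc k"
        using elim \<open>k < n\<close> by (intro mult_mono power_decreasing) auto
      finally show ?case .
    qed
    moreover have "0 < norm (g 0) + 1" by (simp add: add_nonneg_pos)
    ultimately show ?thesis by blast
  qed
qed

section \<open>Invariance of domain and transfer of parametrizations\<close>

lemma dim_coordinate_subspace_le:
  "dim {w :: complex^'m. \<forall>i. i \<notin> J \<longrightarrow> w $ i = 0} \<le> 2 * card J"
proof -
  \<comment> \<open>\<open>dim\<close> is the real dimension, so each free complex coordinate
    contributes two vectors.\<close>
  let ?B = "(\<lambda>j. axis j 1) ` J \<union> (\<lambda>j. axis j \<i>) ` J :: (complex^'m) set"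
  have "{w :: complex^'m. \<forall>i. i \<notin> J \<longrightarrow> w $ i = 0} \<subseteq> span ?B"
  proof
    fix w :: "complex^'m" assume "w \<in> {w. \<forall>i. i \<notin> J \<longrightarrow> w $ i = 0}"
    then have w: "w $ i = 0" if "i \<notin> J" for i using that by blast
    have "(Re (w $ j) *\<^sub>R axis j 1 + Im (w $ j) *\<^sub>R axis j \<i>) $ i = (if i = j then w $ j else 0)"
      for i j by (simp add: axis_def complex_eq_iff)
    then have "w = (\<Sum>j\<in>J. Re (w $ j) *\<^sub>R axis j 1 + Im (w $ j) *\<^sub>R axis j \<i>)"
      using w by (simp add: vec_eq_iff)
    also have "\<dots> \<in> span ?B"
      by (intro span_sum span_add span_scale) (auto intro: span_base)
    finally show "w \<in> span ?B" .
  qed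
  then have "dim {w :: complex^'m. \<forall>i. i \<notin> J \<longrightarrow> w $ i = 0} \<le> card ?B"
    by (rule dim_le_card) simp
  also have "\<dots> \<le> card ((\<lambda>j. axis j 1 :: complex^'m) ` J) + card ((\<lambda>j. axis j \<i> :: complex^'m) ` J)"
    by (rule card_Un_le)
  also have "\<dots> \<le> 2 * card J"
    using card_image_le [of J "\<lambda>j. axis j 1 :: complex^'m"]
      card_image_le [of J "\<lambda>j. axis j \<i> :: complex^'m"] by simp
  finally show ?thesis .
qed

text \<open>In the chart, \<open>q\<close> becomes a continuous injection from an open set of real
  dimension \<open>2 * CARD('p)\<close> into a subspace of no larger dimension, so its image is
  relatively open there. Injectivity of \<open>\<phi>\<close> on \<open>V\<close> pulls this back to
  \<open>Y\<close>.\<close>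

lemma openin_injective_image_of_chart:
  fixes q :: "complex^'p \<Rightarrow> complex^'m"
  assumes chart: "biholomorphic_between \<phi> V W" "card J = CARD('p)"
      "\<phi> ` (Y \<inter> V) = {w\<in>W. \<forall>i. i \<notin> J \<longrightarrow> w $ i = 0}"
    and "open U" "continuous_on U q" "inj_on q U" "q ` U \<subseteq> Y \<inter> V"
  shows "openin (top_of_set Y) (q ` U)"
proof -
  let ?S = "{w :: complex^'m. \<forall>i. i \<notin> J \<longrightarrow> w $ i = 0}"
  have \<phi>: "open V" "inj_on \<phi> V" "continuous_on V \<phi>"
    using chart(1) unfolding biholomorphic_between_def bij_betw_def
    by (auto intro: holomorphic_map_imp_continuous_on)
  have "openin (top_of_set ?S) ((\<phi> \<circ> q) ` U)"
  proof (rule invariance_of_domain_subspaces [where U = UNIV])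
    show "openin (top_of_set UNIV) U" using \<open>open U\<close> by simp
    show "subspace ?S" by (auto simp: subspace_def)
    show "dim ?S \<le> dim (UNIV :: (complex^'p) set)"
      using dim_coordinate_subspace_le [of J] chart(2) by (simp add: dim_UNIV mult.commute)
    show "continuous_on U (\<phi> \<circ> q)"
      using assms(5,7) \<phi>(3) by (intro continuous_on_compose) (auto intro: continuous_on_subset)
    show "inj_on (\<phi> \<circ> q) U"
      using assms(6,7) \<phi>(2) by (intro comp_inj_on) (auto intro: inj_on_subset)
    show "\<phi> \<circ> q \<in> U \<rightarrow> ?S" using chart(3) assms(7) by fastforce
  qed simp
  then obtain T where T: "open T" "(\<phi> \<circ> q) ` U = ?S \<inter> T"
    by (auto simp: openin_open)
  have "q ` U = Y \<inter> (V \<inter> \<phi> -` T)"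
  proof
    show "q ` U \<subseteq> Y \<inter> (V \<inter> \<phi> -` T)" using assms(7) T(2) by force
    show "Y \<inter> (V \<inter> \<phi> -` T) \<subseteq> q ` U"
    proof
      fix y assume y: "y \<in> Y \<inter> (V \<inter> \<phi> -` T)"
      then have "\<phi> y \<in> ?S \<inter> T" using chart(3) by blast
      then obtain u where "u \<in> U" "\<phi> y = \<phi> (q u)" using T(2) by (metis (no_types, lifting) comp_apply imageE)
      then show "y \<in> q ` U" using y assms(7) \<phi>(2) by (metis IntD1 IntD2 imageI inj_onD subsetD)
    qed
  qed
  moreover have "open (V \<inter> \<phi> -` T)"
    using \<phi> T(1) continuous_open_preimage by blast
  ultimately show ?thesis by (auto simp: openin_open)
qed

lemma holomorphic_map_on_subset_imp_continuous_on:
  assumes "holomorphic_map_on_subset f A"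
  shows "continuous_on A f"
  unfolding continuous_on_eq_continuous_within
proof
  fix y assume "y \<in> A"
  then obtain V h where V: "open V" "y \<in> V" "holomorphic_map h V" "\<forall>z\<in>V \<inter> A. h z = f z"
    using assms unfolding holomorphic_map_on_subset_def by blast
  have "continuous_on (A \<inter> V) f"
    using holomorphic_map_imp_continuous_on [OF V(3)] V(4)
    by (metis Int_commute continuous_on_cong continuous_on_subset inf_le1)
  then have "continuous (at y within A \<inter> V) f"
    using V(2) \<open>y \<in> A\<close> by (simp add: continuous_on_eq_continuous_within)
  moreover have "at y within A \<inter> V = at y within A"
    using V(1,2) by (intro at_within_nhd [of _ V]) auto
  ultimately show "continuous (at y within A) f" by simp
qed

lemma holomorphic_map_on_subset_inv_subset:
  assumes "holomorphic_map_on_subset (the_inv_into U q) (q ` U)" "inj_on q U" "U' \<subseteq> U"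
  shows "holomorphic_map_on_subset (the_inv_into U' q) (q ` U')"
proof -
  have inv_eq: "the_inv_into U' q z = the_inv_into U q z" if "z \<in> q ` U'" for z
    using that assms(2,3) by (auto simp: the_inv_into_f_f inj_on_subset subset_iff)
  show ?thesis
    unfolding holomorphic_map_on_subset_def
  proof
    fix y assume "y \<in> q ` U'"
    then have "y \<in> q ` U" using assms(3) by blast
    then obtain V h where "open V" "y \<in> V" "holomorphic_map h V"
        "\<forall>z\<in>V \<inter> q ` U. h z = the_inv_into U q z"
      using assms(1) unfolding holomorphic_map_on_subset_def by blast
    then show "\<exists>V h. open V \<and> y \<in> V \<and> holomorphic_map h V \<and>
        (\<forall>z\<in>V \<inter> q ` U'. h z = the_inv_into U' q z)"
      using inv_eq assms(3) by (intro exI [of _ V] exI [of _ h]) auto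
  qed
qed

text \<open>The image of \<open>U'\<close> is the preimage of \<open>U'\<close> under the continuous
  inverse of \<open>q\<close>, hence open in the image of \<open>U\<close>, which is open in
  \<open>X\<close>.\<close>

lemma parametrization_at_subset:
  assumes q: "parametrization_at q U u0 X x0" and "open U'" "u0 \<in> U'" "U' \<subseteq> U"
  shows "parametrization_at q U' u0 X x0"
proof -
  note q' = q [unfolded parametrization_at_def]
  let ?g = "the_inv_into U q"
  have "q ` U' = q ` U \<inter> ?g -` U'"
    using q' \<open>U' \<subseteq> U\<close> by (auto simp: the_inv_into_f_f subset_iff image_iff)
  moreover have "openin (top_of_set (q ` U)) (q ` U \<inter> ?g -` U')"
    using q' \<open>open U'\<close> by (intro continuous_openin_preimage_gen
        holomorphic_map_on_subset_imp_continuous_on) auto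
  ultimately have "openin (top_of_set X) (q ` U')"
    using q' openin_trans by (metis (no_types))
  moreover have "holomorphic_map_on_subset (the_inv_into U' q) (q ` U')"
    using q' assms(4) holomorphic_map_on_subset_inv_subset by blast
  moreover have "inj_on q U'" "holomorphic_map q U'"
    using q' assms(4) inj_on_subset holomorphic_map_mono by blast+
  ultimately show ?thesis
    using q' assms(2,3) by (simp add: parametrization_at_def)
qed

text \<open>Only the openness of the image refers to the submanifold; the remaining clauses carry
  over from \<open>X\<close> unchanged.\<close>

lemma parametrization_at_of_image_subset:
  fixes q :: "complex^'p \<Rightarrow> complex^'m"
  assumes q: "parametrization_at q U u0 X x0"
    and chart: "biholomorphic_between \<phi> V W" "card J = CARD('p)"
      "\<phi> ` (Y \<inter> V) = {w\<in>W. \<forall>i. i \<notin> J \<longrightarrow> w $ i = 0}"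
    and "q ` U \<subseteq> Y \<inter> V"
  shows "parametrization_at q U u0 Y x0"
proof -
  have "openin (top_of_set Y) (q ` U)"
    using q assms(5) unfolding parametrization_at_def
    by (intro openin_injective_image_of_chart [OF chart] holomorphic_map_imp_continuous_on) auto
  then show ?thesis using q by (simp add: parametrization_at_def)
qed

text \<open>Taking \<open>q' = q\<close> makes the difference zero, which is small of every
  order.\<close>

lemma tangency_order_common_parametrization:
  fixes q :: "complex^'p \<Rightarrow> complex^'m"
  assumes "parametrization_at q U u0 X x0" "parametrization_at q U u0 Y x0"
  shows "tangency_order TYPE('p) X Y x0 = \<infinity>"
proof -
  have "tangency_order_ge TYPE('p) X Y x0 k" for k
    unfolding tangency_order_ge_def
    by (intro exI [of _ U] exI [of _ u0] exI [of _ q] conjI assms) simp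
  then have "ereal (real n) \<le> tangency_order TYPE('p) X Y x0" for n
    unfolding tangency_order_def by (intro Sup_upper) (auto intro!: exI [of _ "int n"])
  then show ?thesis
    by (intro ereal_top) (meson ereal_less_eq(3) order_trans real_arch_simple)
qed

section \<open>Upper and lower bounds along a ray in the parameter space\<close>

lemma holomorphic_maps_smallo_imp_bigo_Suc_on_ray:
  fixes q q' :: "complex^'p \<Rightarrow> complex^'m"
  assumes hol: "holomorphic_map q U" "holomorphic_map q' U" and U: "open U" "u0 \<in> U"
    and eq: "q u0 = q' u0"
    and small: "(\<lambda>u. norm (q u - q' u)) \<in> o[at u0 within U](\<lambda>u. norm (u - u0) ^ k)"
  obtains C where "0 < C" "\<forall>\<^sub>F t in at_right (0::real).
    norm (q (u0 + of_real t *s v) - q' (u0 + of_real t *s v)) \<le> C * t ^ Suc k"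
proof -
  obtain e where e: "0 < e" "ball u0 e \<subseteq> U" using U open_contains_ball by blast
  define r where "r = e / (norm v + 1)"
  have v1: "0 < norm v + 1" by (simp add: add_nonneg_pos)
  have r: "0 < r" using e(1) v1 by (simp add: r_def)
  have in_U: "u0 + t *s v \<in> U" if "t \<in> ball 0 r" for t
  proof -
    have "norm t * norm v \<le> norm t * (norm v + 1)" by (simp add: mult_left_mono)
    also have "\<dots> < e" using that v1 by (simp add: r_def field_simps)
    finally show ?thesis using e(2) by (auto simp: dist_norm norm_vector_scalar_mult_complex)
  qed
  let ?f = "\<lambda>i t. q (u0 + t *s v) $ i - q' (u0 + t *s v) $ i"
  have "\<forall>i. \<exists>C>0. \<forall>\<^sub>F t in at_right (0::real). norm (?f i (of_real t)) \<le> C * t ^ Suc k"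
  proof
    fix i
    show "\<exists>C>0. \<forall>\<^sub>F t in at_right (0::real). norm (?f i (of_real t)) \<le> C * t ^ Suc k"
    proof (rule holomorphic_smallo_imp_bigo_Suc [OF _ r])
      show "?f i holomorphic_on ball 0 r"
        using in_U by (intro holomorphic_on_diff holomorphic_map_slice [OF hol(1)]
            holomorphic_map_slice [OF hol(2)])
      fix c :: real assume "0 < c"
      \<comment> \<open>On the ray \<open>norm (u - u0)\<close> is \<open>t * norm v\<close>, so
        \<open>c'\<close> absorbs the factor \<open>norm v ^ k\<close>; adding 1 keeps the
        denominator positive.\<close>
      define c' where "c' = c / (norm v ^ k + 1)"
      have vk: "0 < norm v ^ k + 1" by (simp add: add_nonneg_pos)
      have c': "0 < c'" "c' * norm v ^ k \<le> c"
        using \<open>0 < c\<close> vk by (auto simp: c'_def field_simps)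
      have "\<forall>\<^sub>F u in at u0 within U. norm (q u - q' u) \<le> c' * norm (u - u0) ^ k"
        using landau_o.smallD [OF small c'(1)] by simp
      then obtain d where d: "0 < d" "\<And>u. \<lbrakk>u \<in> U; u \<noteq> u0; dist u u0 < d\<rbrakk>
          \<Longrightarrow> norm (q u - q' u) \<le> c' * norm (u - u0) ^ k"
        unfolding eventually_at by blast
      \<comment> \<open>The filter omits \<open>u0\<close> itself, where the difference vanishes by
        \<open>eq\<close>; this point is met when \<open>v = 0\<close>.\<close>
      have near: "norm (q u - q' u) \<le> c' * norm (u - u0) ^ k" if "u \<in> U" "dist u u0 < d" for u
        using d(2) that eq c'(1) by (cases "u = u0") auto
      have "\<forall>\<^sub>F t in at_right (0::real). dist (u0 + of_real t *s v) u0 < d"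
        using tendstoD [OF tendsto_ray [of u0 v] d(1)] by simp
      moreover have "\<forall>\<^sub>F t in at_right (0::real). 0 < t \<and> t < r"
        unfolding eventually_at_right_field using r by (intro exI [of _ r]) auto
      ultimately show "\<forall>\<^sub>F t in at_right (0::real). norm (?f i (of_real t)) \<le> c * t ^ k"
      proof eventually_elim
        case (elim t)
        let ?u = "u0 + of_real t *s v"
        have "norm (?f i (of_real t)) \<le> norm (q ?u - q' ?u)"
          using Finite_Cartesian_Product.norm_nth_le [of "q ?u - q' ?u" i] by simp
        also have "\<dots> \<le> c' * norm (?u - u0) ^ k"
          using elim by (intro near in_U) auto
        also have "\<dots> = (c' * norm v ^ k) * t ^ k"
          using elim by (simp add: norm_vector_scalar_mult_complex power_mult_distrib)
        also have "\<dots> \<le> c * t ^ k"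
          using elim c'(2) by (intro mult_right_mono) auto
        finally show ?case .
      qed
    qed
  qed
  from choice [OF this] obtain C where C: "\<And>i. 0 < C i"
    "\<And>i. \<forall>\<^sub>F t in at_right (0::real). norm (?f i (of_real t)) \<le> C i * t ^ Suc k"
    by auto
  have "\<forall>\<^sub>F t in at_right (0::real). \<forall>i. norm (?f i (of_real t)) \<le> C i * t ^ Suc k"
    using C(2) by (simp add: eventually_all_finite)
  then have "\<forall>\<^sub>F t in at_right (0::real).
    norm (q (u0 + of_real t *s v) - q' (u0 + of_real t *s v)) \<le> sum C UNIV * t ^ Suc k"
  proof eventually_elim
    case (elim t)
    have "norm (q (u0 + of_real t *s v) - q' (u0 + of_real t *s v))
        \<le> (\<Sum>i\<in>UNIV. norm (?f i (of_real t)))"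
      unfolding norm_vec_def
      using L2_set_le_sum [of UNIV "\<lambda>i. norm (?f i (of_real t))"] by simp
    also have "\<dots> \<le> (\<Sum>i\<in>UNIV. C i * t ^ Suc k)" using elim by (intro sum_mono) auto
    finally show ?case by (simp add: sum_distrib_right)
  qed
  moreover have "0 < sum C UNIV" using C(1) by (intro sum_pos) auto
  ultimately show thesis by (rule that [rotated])
qed

text \<open>If \<open>\<nu> < n\<close>, division by \<open>t powr \<nu>\<close> leaves
  \<open>C * t powr (n - \<nu>)\<close>, which tends to 0 and so cannot stay above
  \<open>A\<close>.\<close>

lemma exponent_le_of_power_bound:
  fixes A C \<nu> :: real
  assumes "0 < A" and le: "\<forall>\<^sub>F t in at_right (0::real). A * t powr \<nu> \<le> C * t ^ n"
  shows "real n \<le> \<nu>"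
proof (rule ccontr)
  assume "\<not> ?thesis"
  then have lim: "((\<lambda>t. C * t powr (real n - \<nu>)) \<longlongrightarrow> C * 0 powr (real n - \<nu>)) (at_right 0)"
    by (intro tendsto_intros tendsto_powr') (auto intro: eventually_mono [OF eventually_at_right_less])
  then have "\<forall>\<^sub>F t in at_right 0. C * t powr (real n - \<nu>) < A"
    using \<open>0 < A\<close> by (intro order_tendstoD(2)) auto
  moreover have "\<forall>\<^sub>F t in at_right (0::real). 0 < t" by (rule eventually_at_right_less)
  ultimately have "\<forall>\<^sub>F t in at_right (0::real). False"
    using le
  proof eventually_elim
    case (elim t)
    have "C * t ^ n = C * t powr (real n - \<nu>) * t powr \<nu>"
      using elim by (simp add: mult.assoc powr_realpow flip: powr_add)
    also have "\<dots> < A * t powr \<nu>" using elim by (intro mult_strict_right_mono) auto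
    finally show False using elim by simp
  qed
  then show False by simp
qed

text \<open>A point of the intersection nearest to \<open>q u\<close> has the form
  \<open>q w\<close>. Component \<open>i\<close> of the chart vanishes there, so \<open>w\<close>
  lies outside the zero-free ball around \<open>u\<close>, and the Lipschitz inverse of
  \<open>q\<close> converts \<open>norm (u - w) \<ge> \<epsilon> * t\<close> into a bound with
  constant \<open>\<epsilon> / L\<close>.\<close>

lemma infdist_Int_ge_on_ray:
  fixes q :: "complex^'p \<Rightarrow> complex^'m"
  assumes q: "parametrization_at q U u0 X x0" and "closed X" "closed Y" "x0 \<in> Y"
    and chart: "biholomorphic_between \<phi> V W" "x0 \<in> V"
      "\<phi> ` (Y \<inter> V) = {w\<in>W. \<forall>i. i \<notin> J \<longrightarrow> w $ i = 0}"
    and R: "ball u0 R \<subseteq> U" "q ` ball u0 R \<subseteq> V"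
    and nz: "w0 \<in> ball u0 R" "i \<notin> J" "\<phi> (q w0) $ i \<noteq> 0"
  obtains v A where "0 < A"
    "\<forall>\<^sub>F t in at_right (0::real). A * t \<le> infdist (q (u0 + of_real t *s v)) (X \<inter> Y)"
proof -
  note q' = q [unfolded parametrization_at_def]
  have "open V" and hol\<phi>: "holomorphic_map \<phi> V"
    using chart(1) by (auto simp: biholomorphic_between_def)
  have "0 < R" using nz(1) by (metis ball_eq_empty empty_iff not_le)
  have "holomorphic_map (\<phi> \<circ> q) (ball u0 R)"
    using q' R hol\<phi> by (intro holomorphic_map_compose) (auto intro: holomorphic_map_mono)
  then obtain v \<epsilon> \<delta> where \<epsilon>: "0 < \<epsilon>" and \<delta>: "0 < \<delta>"
    and cone: "\<And>t x. \<lbrakk>0 < t; t < \<delta>; x \<in> ball (u0 + complex_of_real t *s v) (\<epsilon> * t)\<rbrakk>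
      \<Longrightarrow> (\<phi> \<circ> q) x $ i \<noteq> 0"
    using holomorphic_map_nonzero_cone [of "\<phi> \<circ> q" u0 R w0 i] nz by (metis comp_apply)
  have x0: "x0 \<in> q ` U" using q' by blast
  then obtain V' h where V': "open V'" "x0 \<in> V'" "holomorphic_map h V'"
      and h: "\<And>z. z \<in> V' \<Longrightarrow> z \<in> q ` U \<Longrightarrow> h z = the_inv_into U q z"
    using q' unfolding holomorphic_map_on_subset_def by (metis IntI)
  obtain s1 L where s1: "0 < s1" "ball x0 s1 \<subseteq> V'" and "0 < L"
    and lip: "\<And>x y. x \<in> ball x0 s1 \<Longrightarrow> y \<in> ball x0 s1 \<Longrightarrow> norm (h x - h y) \<le> L * norm (x - y)"
    using holomorphic_map_Lipschitz_near [OF V'(3,1,2)] by blast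
  obtain T where T: "open T" "q ` U = X \<inter> T"
    using q' by (auto simp: openin_open)
  have "open (ball x0 s1 \<inter> T \<inter> V)" "x0 \<in> ball x0 s1 \<inter> T \<inter> V"
    using T \<open>open V\<close> s1(1) x0 chart(2) by auto
  \<comment> \<open>Once \<open>q u\<close> is within \<open>s/2\<close> of \<open>x0\<close>, a
    nearest point of the intersection is within \<open>s/2\<close> of \<open>q u\<close>, because
    \<open>x0\<close> is a competitor. Both points then lie in this ball, where the Lipschitz bound,
    the image of \<open>q\<close> and the chart are all available.\<close>
  then obtain s where s: "0 < s" "ball x0 s \<subseteq> ball x0 s1 \<inter> T \<inter> V"
    using open_contains_ball by blast
  have "isCont q u0"
    using q' by (meson continuous_on_eq_continuous_at holomorphic_map_imp_continuous_on)
  then have "((\<lambda>t. q (u0 + of_real t *s v)) \<longlongrightarrow> x0) (at_right 0)"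
    using isCont_tendsto_compose [OF _ tendsto_ray [of u0 v], of q] q' by simp
  then have "\<forall>\<^sub>F t in at_right (0::real). dist (q (u0 + of_real t *s v)) x0 < s/2"
    using s(1) by (intro tendstoD) auto
  moreover have "\<forall>\<^sub>F t in at_right (0::real). dist (u0 + of_real t *s v) u0 < R"
    using tendstoD [OF tendsto_ray [of u0 v] \<open>0 < R\<close>] by simp
  moreover have "\<forall>\<^sub>F t in at_right (0::real). 0 < t \<and> t < \<delta>"
    unfolding eventually_at_right_field using \<delta> by (intro exI [of _ \<delta>]) auto
  ultimately have "\<forall>\<^sub>F t in at_right (0::real).
      \<epsilon> / L * t \<le> infdist (q (u0 + of_real t *s v)) (X \<inter> Y)"
  proof eventually_elim
    case (elim t)
    define u where "u = u0 + of_real t *s v"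
    have u: "u \<in> U" "dist (q u) x0 < s/2"
      using elim R(1) by (auto simp: u_def dist_commute)
    have x0XY: "x0 \<in> X \<inter> Y" using x0 T(2) \<open>x0 \<in> Y\<close> by blast
    then obtain z where z: "z \<in> X \<inter> Y" "infdist (q u) (X \<inter> Y) = dist (q u) z"
      using infdist_attains_inf [of "X \<inter> Y" "q u"] \<open>closed X\<close> \<open>closed Y\<close> by blast
    have "dist (q u) z < s/2"
      using infdist_le [OF x0XY, of "q u"] z(2) u(2) by simp
    then have "z \<in> ball x0 s" "q u \<in> ball x0 s"
      using u(2) dist_triangle [of x0 z "q u"] s(1) by (auto simp: dist_commute)
    with s(2) have zs: "z \<in> ball x0 s1" "z \<in> T" "z \<in> V" and us: "q u \<in> ball x0 s1" by auto
    then obtain w where w: "w \<in> U" "z = q w" using z(1) T(2) by blast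
    have "h z = w" "h (q u) = u"
      using h s1(2) zs(1) us u(1) w q' by (auto simp: the_inv_into_f_f subset_iff)
    then have "norm (u - w) \<le> L * dist (q u) z"
      using lip [OF us zs(1)] by (simp add: dist_norm)
    moreover have "\<epsilon> * t \<le> norm (u - w)"
    proof (rule ccontr)
      assume "\<not> ?thesis"
      then have "w \<in> ball u (\<epsilon> * t)" by (simp add: dist_norm)
      then have "\<phi> z $ i \<noteq> 0" using cone [of t w] elim w(2) by (simp add: u_def)
      moreover have "\<phi> z \<in> \<phi> ` (Y \<inter> V)" using z(1) zs(3) by blast
      ultimately show False using nz(2) unfolding chart(3) by blast
    qed
    ultimately have "\<epsilon> * t \<le> L * dist (q u) z" by linarith
    then show ?case
      using z(2) \<open>0 < L\<close> by (simp add: u_def [symmetric] field_simps)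
  qed
  moreover have "0 < \<epsilon> / L" using \<epsilon> \<open>0 < L\<close> by simp
  ultimately show thesis by (rule that [rotated])
qed

section \<open>Comparison of the two bounds and the final inequality\<close>

lemma Suc_tangency_le_regular_separation_exponent:
  fixes X Y :: "(complex^'m) set"
  assumes X: "closed X" and Y: "closed_analytic_submanifold CARD('p::finite) Y" and x0: "x0 \<in> X \<inter> Y"
    and fin: "tangency_order TYPE('p) X Y x0 \<noteq> \<infinity>"
    and tan: "tangency_order_ge TYPE('p) X Y x0 (int k)"
    and sep: "regular_separation_exponent X Y x0 \<nu>"
  shows "real (Suc k) \<le> \<nu>"
proof -
  obtain U u0 and q q' :: "complex^'p \<Rightarrow> complex^'m" where
      q: "parametrization_at q U u0 X x0" and q': "parametrization_at q' U u0 Y x0"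
    and small: "(\<lambda>u. norm (q u - q' u)) \<in> o[at u0 within U](\<lambda>u. norm (u - u0) ^ k)"
    using tan unfolding tangency_order_ge_def by (auto simp: power_int_of_nat)
  note qd = q [unfolded parametrization_at_def] and q'd = q' [unfolded parametrization_at_def]
  have "closed Y" using Y by (simp add: closed_analytic_submanifold_def)
  obtain V W \<phi> J where chart: "x0 \<in> V" "biholomorphic_between \<phi> V W" "card J = CARD('p)"
      "\<phi> ` (Y \<inter> V) = {w\<in>W. \<forall>i. i \<notin> J \<longrightarrow> w $ i = 0}"
    using Y x0 unfolding closed_analytic_submanifold_def by blast
  have \<phi>: "open V" "inj_on \<phi> V" "\<phi> ` V = W"
    using chart(2) by (auto simp: biholomorphic_between_def bij_betw_def)
  have "open (U \<inter> q -` V)"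
    using qd \<phi>(1) by (intro continuous_open_preimage holomorphic_map_imp_continuous_on) auto
  \<comment> \<open>On this ball \<open>q\<close> takes values in \<open>V\<close>, so the
    components of \<open>\<phi>\<close> outside \<open>J\<close> serve as equations of
    \<open>Y\<close> pulled back by \<open>q\<close>.\<close>
  then obtain R where "0 < R" and "ball u0 R \<subseteq> U \<inter> q -` V"
    using qd chart(1) by (metis IntI open_contains_ball vimageI2)
  then have R: "ball u0 R \<subseteq> U" "q ` ball u0 R \<subseteq> V" by auto
  \<comment> \<open>Otherwise \<open>X\<close> and \<open>Y\<close> coincide near \<open>x0\<close>, and taking \<open>q\<close> for both of them shows that the order
    of tangency is infinite.\<close>
  have "\<exists>w\<in>ball u0 R. \<exists>i. i \<notin> J \<and> \<phi> (q w) $ i \<noteq> 0"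
  proof (rule ccontr)
    assume "\<not> ?thesis"
    then have "\<phi> (q w) \<in> \<phi> ` (Y \<inter> V)" if "w \<in> ball u0 R" for w
      unfolding chart(4) using that R(2) \<phi>(3) by blast
    then have "q w \<in> Y \<inter> V" if "w \<in> ball u0 R" for w
      using inj_on_image_mem_iff [OF \<phi>(2), of "q w" "Y \<inter> V"] R(2) that by blast
    then have sub: "q ` ball u0 R \<subseteq> Y \<inter> V" by blast
    have qX: "parametrization_at q (ball u0 R) u0 X x0"
      using \<open>0 < R\<close> R(1) by (intro parametrization_at_subset [OF q]) auto
    have "parametrization_at q (ball u0 R) u0 Y x0"
      by (rule parametrization_at_of_image_subset [OF qX chart(2-4) sub])
    then show False using tangency_order_common_parametrization [OF qX] fin by simp
  qed
  then obtain w0 i where nz: "w0 \<in> ball u0 R" "i \<notin> J" "\<phi> (q w0) $ i \<noteq> 0" by blast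
  obtain v A where "0 < A"
    and far: "\<forall>\<^sub>F t in at_right (0::real). A * t \<le> infdist (q (u0 + of_real t *s v)) (X \<inter> Y)"
    using infdist_Int_ge_on_ray [OF q X \<open>closed Y\<close> _ chart(2,1,4) R nz] x0 by blast
  obtain C where near: "\<forall>\<^sub>F t in at_right (0::real).
      norm (q (u0 + of_real t *s v) - q' (u0 + of_real t *s v)) \<le> C * t ^ Suc k"
  proof (rule holomorphic_maps_smallo_imp_bigo_Suc_on_ray [OF _ _ _ _ _ small, of v])
    show "holomorphic_map q U" "holomorphic_map q' U" "open U" "u0 \<in> U" "q u0 = q' u0"
      using qd q'd by auto
  qed
  obtain c N where "0 < \<nu>" "0 < c" "open N" "x0 \<in> N"
    and N: "\<And>x. x \<in> N \<Longrightarrow> c * infdist x (X \<inter> Y) powr \<nu> \<le> infdist x X + infdist x Y"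
    using sep unfolding regular_separation_exponent_def by blast
  have in_U: "\<forall>\<^sub>F t in at_right (0::real). u0 + of_real t *s v \<in> U"
    using topological_tendstoD [OF tendsto_ray [of u0 v], of U] qd by simp
  have "isCont q u0"
    using qd by (meson continuous_on_eq_continuous_at holomorphic_map_imp_continuous_on)
  then have "((\<lambda>t. q (u0 + of_real t *s v)) \<longlongrightarrow> x0) (at_right 0)"
    using isCont_tendsto_compose [OF _ tendsto_ray [of u0 v], of q] qd by simp
  then have in_N: "\<forall>\<^sub>F t in at_right (0::real). q (u0 + of_real t *s v) \<in> N"
    using \<open>open N\<close> \<open>x0 \<in> N\<close> by (rule topological_tendstoD)
  \<comment> \<open>Since \<open>q ?u\<close> lies in \<open>X\<close>, the separation inequality
    compares only its distance to \<open>Y\<close>, bounded above by \<open>near\<close>, with its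
    distance to the intersection, bounded below by \<open>far\<close>.\<close>
  have "\<forall>\<^sub>F t in at_right (0::real). c * A powr \<nu> * t powr \<nu> \<le> C * t ^ Suc k"
    using far near in_U in_N eventually_at_right_less [of 0]
  proof eventually_elim
    case (elim t)
    let ?u = "u0 + of_real t *s v"
    have "q ?u \<in> X" "q' ?u \<in> Y"
      using elim(3) qd q'd openin_imp_subset by blast+
    have "c * A powr \<nu> * t powr \<nu> = c * (A * t) powr \<nu>"
      using \<open>0 < A\<close> elim(5) by (simp add: powr_mult)
    also have "\<dots> \<le> c * infdist (q ?u) (X \<inter> Y) powr \<nu>"
      using \<open>0 < c\<close> \<open>0 < \<nu>\<close> \<open>0 < A\<close> elim(1,5) by (intro mult_left_mono powr_mono2) auto
    also have "\<dots> \<le> infdist (q ?u) X + infdist (q ?u) Y" using N elim(4) by blast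
    also have "\<dots> = infdist (q ?u) Y" using \<open>q ?u \<in> X\<close> by simp
    also have "\<dots> \<le> norm (q ?u - q' ?u)"
      using infdist_le [OF \<open>q' ?u \<in> Y\<close>, of "q ?u"] by (simp add: dist_norm)
    also have "\<dots> \<le> C * t ^ Suc k" by (rule elim(2))
    finally show ?case .
  qed
  moreover have "0 < c * A powr \<nu>" using \<open>0 < c\<close> \<open>0 < A\<close> by simp
  ultimately show ?thesis using exponent_le_of_power_bound by blast
qed

theorem mainTheorem3:
  fixes X Y :: "(complex^'m) set" and x0 :: "complex^'m"
  assumes "CARD('m) \<ge> 2"
    and "closed_analytic_submanifold CARD('p::finite) X"
    and "closed_analytic_submanifold CARD('p) Y"
    and "x0 \<in> X \<inter> Y"
    and "\<bar>tangency_order TYPE('p) X Y x0\<bar> \<noteq> \<infinity>"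
    and "Lojasiewicz_exponent X Y x0 \<ge> 1"
  shows "tangency_order TYPE('p) X Y x0 \<le> Lojasiewicz_exponent X Y x0 - 1"
  unfolding tangency_order_def
proof (rule Sup_least, clarify)
  fix k assume tan: "tangency_order_ge TYPE('p) X Y x0 k"
  have "ereal (of_int k + 1) \<le> Lojasiewicz_exponent X Y x0"
  proof (cases "k \<le> 0")
    case True
    then have "ereal (of_int k + 1) \<le> 1" by (simp add: one_ereal_def)
    then show ?thesis using assms(6) by (rule order_trans)
  next
    case False
    then obtain n where k: "k = int n" by (metis nat_0_le nle_le)
    show ?thesis
      unfolding Lojasiewicz_exponent_def
    proof (rule Inf_greatest, clarify)
      fix \<nu> assume "regular_separation_exponent X Y x0 \<nu>"
      then have "real (Suc n) \<le> \<nu>"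
        using Suc_tangency_le_regular_separation_exponent [OF _ assms(3,4)] assms(2,5) tan
        unfolding k closed_analytic_submanifold_def by fastforce
      then show "ereal (of_int k + 1) \<le> ereal \<nu>" by (simp add: k add.commute)
    qed
  qed
  \<comment> \<open>The exponent is an extended real, so moving 1 across is checked case by case;
    the lower bound rules out the value minus infinity.\<close>
  then show "ereal (of_int k) \<le> Lojasiewicz_exponent X Y x0 - 1"
    by (cases "Lojasiewicz_exponent X Y x0") (auto simp: one_ereal_def)
qed

end
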